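(* The sequence $\{x^k\}\subset K$ generated by the cutting plane algorithm converges to an optimal solution of (PDSP) after a finite number of steps.
   Context: Setting. Let $v_1,\dots,v_n$ be $n$ given locations in $\mathbb{R}^s$ ($s\ge 1$), let $r\in(0,2]$, and let $Q=[q_{ij}]$ be the $n\times n$ matrix with $q_{ij}=\|v_i-v_j\|^r$, where $\|\cdot\|$ is the Euclidean norm. Let $p$ be the number of locations to be selected among the $n$ given ones. Put $f(x)=\tfrac12\langle Qx,x\rangle$ for $x\in\mathbb{R}^n$ and $K=\{x\in\{0,1\}^n:\ \sum_{i=1}^n x_i=p\}$. The $p$-dispersion-sum problem (PDSP) is $\max_{x\in K} f(x)$. Define $h(x,y)=\langle\nabla f(y),x-y\rangle+f(y)$ for $x,y\in\mathbb{R}^n$. For $A\subset K$ let $\Gamma_A=\{(x,\theta)\in\mathbb{R}^{n+1}:\ x\in K,\ \theta\le h(x,y)\ \text{for all } y\in A\}$. Cutting plane algorithm. Take $x^0\in K$; set $A_0=\{x^0\}$, $\mathrm{LB}_0=f(x^0)$, $k=1$. While there exists $(x^k,\theta^k)\in\Gamma_{A_{k-1}}$ with $\theta^k>\mathrm{LB}_{k-1}$: set $\mathrm{LB}_k=\max\{\mathrm{LB}_{k-1},f(x^k)\}$, set $A_k=A_{k-1}\cup\{x^k\}$, and replace $k$ by $k+1$. The algorithm terminates when no such pair exists. *)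

theory Defs
  imports "HOL-Analysis.Analysis" "HOL-Library.Extended_Nat"
begin

definition dist_matrix :: "('n \<Rightarrow> real ^ 's) \<Rightarrow> real \<Rightarrow> real ^ 'n ^ 'n" where
  "dist_matrix v r = (\<chi> i j. norm (v i - v j) powr r)"

definition dispersion :: "('n::finite \<Rightarrow> real ^ 's) \<Rightarrow> real \<Rightarrow> real ^ 'n \<Rightarrow> real" where
  "dispersion v r x = 1 / 2 * ((dist_matrix v r *v x) \<bullet> x)"

definition selections :: "nat \<Rightarrow> (real ^ 'n::finite) set" where
  "selections p = {x. (\<forall>i. x $ i \<in> {0, 1}) \<and> (\<Sum>i\<in>UNIV. x $ i) = real p}"

definition gradient :: "('a::real_inner \<Rightarrow> real) \<Rightarrow> 'a \<Rightarrow> 'a" where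
  "gradient f y = (THE D. GDERIV f y :> D)"

definition cut :: "('a::real_inner \<Rightarrow> real) \<Rightarrow> 'a \<Rightarrow> 'a \<Rightarrow> real" where
  "cut f x y = gradient f y \<bullet> (x - y) + f y"

definition cut_region :: "('a::real_inner \<Rightarrow> real) \<Rightarrow> 'a set \<Rightarrow> 'a set \<Rightarrow> ('a \<times> real) set" where
  "cut_region f K A = {(x, \<theta>). x \<in> K \<and> (\<forall>y\<in>A. \<theta> \<le> cut f x y)}"

primrec cut_points :: "(nat \<Rightarrow> 'a) \<Rightarrow> nat \<Rightarrow> 'a set" where
  "cut_points x 0 = {x 0}"
| "cut_points x (Suc k) = cut_points x k \<union> {x (Suc k)}"

primrec lower_bound :: "('a \<Rightarrow> real) \<Rightarrow> (nat \<Rightarrow> 'a) \<Rightarrow> nat \<Rightarrow> real" where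
  "lower_bound f x 0 = f (x 0)"
| "lower_bound f x (Suc k) = max (lower_bound f x k) (f (x (Suc k)))"

text \<open>
  A complete run of the cutting plane algorithm with generated iterates \<open>x 0, ..., x N\<close>
  (all \<open>x k\<close> if \<open>N = \<infinity>\<close>). Any admissible pair may be chosen in each step, and a finite
  run ends only when no admissible pair is left. Infinite runs are allowed here, so that finite
  termination is a property to be proved. The values of \<open>x\<close> and \<open>\<theta>\<close> beyond \<open>N\<close>, and
  \<open>\<theta> 0\<close>, are irrelevant.
\<close>

definition cutting_plane_run ::
  "('a::real_inner \<Rightarrow> real) \<Rightarrow> 'a set \<Rightarrow> (nat \<Rightarrow> 'a) \<Rightarrow> (nat \<Rightarrow> real) \<Rightarrow> enat \<Rightarrow> bool" where
  "cutting_plane_run f K x \<theta> N \<longleftrightarrow>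
     x 0 \<in> K \<and>
     (\<forall>k. enat (Suc k) \<le> N \<longrightarrow>
        (x (Suc k), \<theta> (Suc k)) \<in> cut_region f K (cut_points x k) \<and>
        \<theta> (Suc k) > lower_bound f x k) \<and>
     (\<forall>m. N = enat m \<longrightarrow>
        \<not> (\<exists>(y, t) \<in> cut_region f K (cut_points x m). t > lower_bound f x m))"

end

theory Submission
  imports Defs "HOL-Real_Asymp.Real_Asymp"
begin

text \<open>
  An iterate that repeats an earlier one admits no \<open>\<theta>\<close> above the lower bound, since the cut at
  \<open>y\<close> takes the value \<open>f y\<close> at \<open>y\<close>; as there are only finitely many selections, the run stops.
  The cuts are valid on the set of selections because \<open>f\<close> is concave along directions with
  coordinate sum zero, so the final lower bound is optimal. This concavity is Schoenberg's theorem
  that \<open>\<parallel>x - y\<parallel> powr r\<close> is conditionally negative definite for \<open>0 < r \<le> 2\<close>.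

  For \<open>r < 2\<close> put \<open>a = r / 2\<close> and \<open>F u = (\<Sum>i j. c i * c j * (u + \<parallel>v i - v j\<parallel>\<^sup>2) powr a)\<close> with
  \<open>(\<Sum>i. c i) = 0\<close>. The derivative of \<open>F\<close> is nonnegative, because \<open>s powr (a - 1)\<close> is a mixture of
  the functions \<open>exp (- t * s)\<close> and the Gaussian kernel is positive semidefinite. As \<open>F u\<close> tends
  to 0 as \<open>u\<close> grows, it follows that \<open>F 0 \<le> 0\<close>.
\<close>

section \<open>Positive semidefinite kernels\<close>

text \<open>A special case of the Schur product theorem. Expanding one inner product over
  \<open>Basis\<close> splits the sum into one sum per basis vector \<open>b\<close>, with weights
  \<open>c i * (v i \<bullet> b)\<close> and the lower power; hence the induction needs
  \<open>c\<close> arbitrary.\<close>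

lemma inner_power_kernel_nonneg:
  fixes v :: "'i \<Rightarrow> 'a::euclidean_space" and c :: "'i \<Rightarrow> real"
  shows "0 \<le> (\<Sum>i\<in>I. \<Sum>j\<in>I. c i * c j * (v i \<bullet> v j) ^ k)"
proof (induction k arbitrary: c)
  case 0
  have "(\<Sum>i\<in>I. \<Sum>j\<in>I. c i * c j) = (\<Sum>i\<in>I. c i)\<^sup>2"
    by (simp add: sum_product power2_eq_square)
  then show ?case by simp
next
  case (Suc k)
  have "(\<Sum>i\<in>I. \<Sum>j\<in>I. c i * c j * (v i \<bullet> v j) ^ Suc k)
      = (\<Sum>i\<in>I. \<Sum>j\<in>I. \<Sum>b\<in>Basis. (c i * (v i \<bullet> b)) * (c j * (v j \<bullet> b)) * (v i \<bullet> v j) ^ k)"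
  proof (intro sum.cong refl)
    fix i j
    have "c i * c j * (v i \<bullet> v j) ^ Suc k = (v i \<bullet> v j) * (c i * c j * (v i \<bullet> v j) ^ k)"
      by simp
    also have "\<dots> = (\<Sum>b\<in>Basis. (v i \<bullet> b) * (v j \<bullet> b)) * (c i * c j * (v i \<bullet> v j) ^ k)"
      by (subst euclidean_inner) (rule refl)
    also have "\<dots> = (\<Sum>b\<in>Basis. (c i * (v i \<bullet> b)) * (c j * (v j \<bullet> b)) * (v i \<bullet> v j) ^ k)"
      unfolding sum_distrib_right by (intro sum.cong refl) (simp only: mult_ac)
    finally show "c i * c j * (v i \<bullet> v j) ^ Suc k
        = (\<Sum>b\<in>Basis. (c i * (v i \<bullet> b)) * (c j * (v j \<bullet> b)) * (v i \<bullet> v j) ^ k)" .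
  qed
  also have "\<dots> = (\<Sum>i\<in>I. \<Sum>b\<in>Basis. \<Sum>j\<in>I. (c i * (v i \<bullet> b)) * (c j * (v j \<bullet> b)) * (v i \<bullet> v j) ^ k)"
    by (intro sum.cong refl sum.swap)
  also have "\<dots> = (\<Sum>b\<in>Basis. \<Sum>i\<in>I. \<Sum>j\<in>I. (c i * (v i \<bullet> b)) * (c j * (v j \<bullet> b)) * (v i \<bullet> v j) ^ k)"
    by (rule sum.swap)
  also have "\<dots> \<ge> 0"
    by (intro sum_nonneg Suc.IH)
  finally show ?case .
qed

text \<open>The exponential series has nonnegative coefficients, so each of its terms is a
  nonnegative multiple of a power kernel.\<close>

lemma exp_inner_kernel_nonneg:
  fixes v :: "'i \<Rightarrow> 'a::euclidean_space" and c :: "'i \<Rightarrow> real"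
  assumes "0 \<le> t"
  shows "0 \<le> (\<Sum>i\<in>I. \<Sum>j\<in>I. c i * c j * exp (t * (v i \<bullet> v j)))"
proof -
  have "(\<lambda>k. \<Sum>i\<in>I. \<Sum>j\<in>I. c i * c j * ((t * (v i \<bullet> v j)) ^ k /\<^sub>R fact k))
      sums (\<Sum>i\<in>I. \<Sum>j\<in>I. c i * c j * exp (t * (v i \<bullet> v j)))"
    by (intro sums_sum sums_mult exp_converges)
  moreover have "0 \<le> (\<Sum>i\<in>I. \<Sum>j\<in>I. c i * c j * ((t * (v i \<bullet> v j)) ^ k /\<^sub>R fact k))" for k
  proof -
    have "(\<Sum>i\<in>I. \<Sum>j\<in>I. c i * c j * ((t * (v i \<bullet> v j)) ^ k /\<^sub>R fact k))
        = (t ^ k / fact k) * (\<Sum>i\<in>I. \<Sum>j\<in>I. c i * c j * (v i \<bullet> v j) ^ k)"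
      by (simp add: sum_distrib_left power_mult_distrib field_simps)
    then show ?thesis
      using inner_power_kernel_nonneg[of c v k I] assms by simp
  qed
  ultimately show ?thesis
    by (rule sums_le[OF _ sums_zero, rotated])
qed

lemma gaussian_kernel_nonneg:
  fixes v :: "'i \<Rightarrow> 'a::euclidean_space" and c :: "'i \<Rightarrow> real"
  assumes "0 \<le> t"
  shows "0 \<le> (\<Sum>i\<in>I. \<Sum>j\<in>I. c i * c j * exp (- t * (norm (v i - v j))\<^sup>2))"
proof -
  \<comment> \<open>Expanding the square leaves two factors that depend on \<open>i\<close> alone
    and \<open>j\<close> alone; these are absorbed into the weights.\<close>
  have "exp (- t * (norm (v i - v j))\<^sup>2)
      = exp (- t * (norm (v i))\<^sup>2) * exp (- t * (norm (v j))\<^sup>2) * exp ((2 * t) * (v i \<bullet> v j))" for i j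
    by (simp add: power2_norm_eq_inner inner_diff inner_commute algebra_simps flip: exp_add)
  then have "(\<Sum>i\<in>I. \<Sum>j\<in>I. c i * c j * exp (- t * (norm (v i - v j))\<^sup>2))
      = (\<Sum>i\<in>I. \<Sum>j\<in>I. (c i * exp (- t * (norm (v i))\<^sup>2)) * (c j * exp (- t * (norm (v j))\<^sup>2))
          * exp ((2 * t) * (v i \<bullet> v j)))"
    by (intro sum.cong refl) (simp only: mult_ac)
  also have "\<dots> \<ge> 0"
    using assms by (intro exp_inner_kernel_nonneg) simp
  finally show ?thesis .
qed

text \<open>Euler's integral under the substitution of \<open>s * t\<close> for \<open>t\<close>. It
  exhibits \<open>s powr - b\<close> as a mixture of the exponentials \<open>exp (- t * s)\<close>
  with nonnegative weights.\<close>

lemma Gamma_integral_scaled: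
  fixes b s :: real
  assumes "0 < b" and "0 < s"
  shows "((\<lambda>t. t powr (b - 1) * exp (- t * s)) has_integral (Gamma b * s powr - b)) {0..}"
proof -
  let ?f = "\<lambda>t::real. t powr (b - 1) / exp t"
  have img: "(\<lambda>t. s * t) ` {0..} = {0..}"
  proof
    show "{0..} \<subseteq> (\<lambda>t. s * t) ` {0..}"
    proof
      fix y :: real assume "y \<in> {0..}"
      then have "y = s * (y / s)" and "y / s \<in> {0..}" using assms by auto
      then show "y \<in> (\<lambda>t. s * t) ` {0..}" by (rule image_eqI)
    qed
  qed (use assms in auto)
  \<comment> \<open>The change of variables transfers absolute integrability together with the
    value, so the nonnegative integrand is first shown absolutely integrable.\<close>
  have "?f absolutely_integrable_on {0..}"
    using Gamma_integral_real[OF \<open>0 < b\<close>]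
    by (intro nonnegative_absolutely_integrable_1) (auto simp: has_integral_iff)
  moreover have "integral {0..} ?f = Gamma b"
    using Gamma_integral_real[OF \<open>0 < b\<close>] by (simp add: has_integral_iff)
  moreover have "(\<lambda>t. \<bar>s\<bar> * ?f (s * t)) absolutely_integrable_on {0..} \<and>
      integral {0..} (\<lambda>t. \<bar>s\<bar> * ?f (s * t)) = Gamma b \<longleftrightarrow>
      ?f absolutely_integrable_on (\<lambda>t. s * t) ` {0..} \<and> integral ((\<lambda>t. s * t) ` {0..}) ?f = Gamma b"
    using assms
    by (intro has_absolute_integral_change_of_variables_1')
       (auto intro!: derivative_eq_intros inj_onI)
  ultimately have "((\<lambda>t. \<bar>s\<bar> * ?f (s * t)) has_integral Gamma b) {0..}"
    unfolding img by (auto simp: has_integral_iff set_lebesgue_integral_eq_integral)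
  then have "((\<lambda>t. s powr - b * (\<bar>s\<bar> * ?f (s * t))) has_integral (s powr - b * Gamma b)) {0..}"
    by (rule has_integral_mult_right)
  moreover have "s powr - b * (\<bar>s\<bar> * ?f (s * t)) = t powr (b - 1) * exp (- t * s)"
    if "t \<in> {0..}" for t
  proof -
    have "s powr - b * (s * s powr (b - 1)) = 1"
      using assms by (simp add: powr_mult_base flip: powr_add)
    then have "s powr - b * s * s powr (b - 1) * (t powr (b - 1) / exp (s * t))
        = t powr (b - 1) / exp (s * t)"
      by (simp add: mult.assoc)
    then show ?thesis
      using assms that by (simp add: powr_mult exp_minus field_simps)
  qed
  ultimately show ?thesis
    by (subst has_integral_cong[where g = "\<lambda>t. s powr - b * (\<bar>s\<bar> * ?f (s * t))"])
       (auto simp: mult.commute)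
qed

text \<open>Integrates the Gaussian kernel over its scale \<open>t\<close>. The shift
  \<open>u\<close> keeps the base positive on the diagonal and contributes only the factor
  \<open>exp (- t * u)\<close>.\<close>

lemma inverse_multiquadric_kernel_nonneg:
  fixes v :: "'i \<Rightarrow> 'a::euclidean_space" and c :: "'i \<Rightarrow> real"
  assumes "finite I" and "0 < b" and "0 < u"
  shows "0 \<le> (\<Sum>i\<in>I. \<Sum>j\<in>I. c i * c j * (u + (norm (v i - v j))\<^sup>2) powr - b)"
proof -
  let ?D = "\<lambda>i j. (norm (v i - v j))\<^sup>2"
  have "((\<lambda>t. \<Sum>i\<in>I. \<Sum>j\<in>I. c i * c j * (t powr (b - 1) * exp (- t * (u + ?D i j))))
      has_integral (\<Sum>i\<in>I. \<Sum>j\<in>I. c i * c j * (Gamma b * (u + ?D i j) powr - b))) {0..}"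
    using assms
    by (intro has_integral_sum has_integral_mult_right Gamma_integral_scaled add_pos_nonneg) auto
  moreover have "0 \<le> (\<Sum>i\<in>I. \<Sum>j\<in>I. c i * c j * (t powr (b - 1) * exp (- t * (u + ?D i j))))"
    if "t \<in> {0..}" for t
  proof -
    have "(\<Sum>i\<in>I. \<Sum>j\<in>I. c i * c j * (t powr (b - 1) * exp (- t * (u + ?D i j))))
        = t powr (b - 1) * exp (- t * u) * (\<Sum>i\<in>I. \<Sum>j\<in>I. c i * c j * exp (- t * ?D i j))"
      by (simp add: sum_distrib_left ring_distribs exp_add exp_diff exp_minus divide_inverse mult_ac)
    then show ?thesis
      using gaussian_kernel_nonneg[of t c v I] that by simp
  qed
  ultimately have "0 \<le> (\<Sum>i\<in>I. \<Sum>j\<in>I. c i * c j * (Gamma b * (u + ?D i j) powr - b))"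
    by (rule has_integral_nonneg)
  also have "\<dots> = Gamma b * (\<Sum>i\<in>I. \<Sum>j\<in>I. c i * c j * (u + ?D i j) powr - b)"
    by (simp add: sum_distrib_left mult_ac)
  finally show ?thesis
    using Gamma_real_pos[OF \<open>0 < b\<close>] by (simp add: zero_le_mult_iff)
qed

section \<open>Powers of the Euclidean distance are conditionally negative definite\<close>

lemma squared_dist_kernel_nonpos:
  fixes v :: "'i \<Rightarrow> 'a::real_inner" and c :: "'i \<Rightarrow> real"
  assumes "(\<Sum>i\<in>I. c i) = 0"
  shows "(\<Sum>i\<in>I. \<Sum>j\<in>I. c i * c j * (norm (v i - v j))\<^sup>2) \<le> 0"
proof -
  let ?n = "\<lambda>i. c i * (norm (v i))\<^sup>2"
  let ?w = "\<Sum>i\<in>I. c i *\<^sub>R v i"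
  have "(\<Sum>i\<in>I. \<Sum>j\<in>I. c i * c j * (norm (v i - v j))\<^sup>2)
      = (\<Sum>i\<in>I. \<Sum>j\<in>I. ?n i * c j + c i * ?n j - 2 * ((c i *\<^sub>R v i) \<bullet> (c j *\<^sub>R v j)))"
    by (intro sum.cong refl)
       (simp add: power2_norm_eq_inner inner_diff inner_commute algebra_simps)
  \<comment> \<open>The first two products vanish with the sum of \<open>c\<close>, leaving -2 times
    the squared norm of \<open>?w\<close>.\<close>
  also have "\<dots> = sum ?n I * sum c I + sum c I * sum ?n I - 2 * (?w \<bullet> ?w)"
    unfolding sum_product inner_sum_left
    by (simp add: inner_sum_right sum.distrib sum_subtractf sum_distrib_left)
  finally show ?thesis
    using assms by simp
qed

lemma shifted_powr_kernel_mono: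
  fixes v :: "'i \<Rightarrow> 'a::euclidean_space" and c :: "'i \<Rightarrow> real"
  assumes "finite I" and "0 < a" and "a < 1" and "0 < u"
  shows "(\<Sum>i\<in>I. \<Sum>j\<in>I. c i * c j * ((norm (v i - v j))\<^sup>2) powr a)
       \<le> (\<Sum>i\<in>I. \<Sum>j\<in>I. c i * c j * (u + (norm (v i - v j))\<^sup>2) powr a)"
proof -
  let ?D = "\<lambda>i j. (norm (v i - v j))\<^sup>2"
  define F where "F = (\<lambda>u. \<Sum>i\<in>I. \<Sum>j\<in>I. c i * c j * (u + ?D i j) powr a)"
  have "F 0 \<le> F u"
  \<comment> \<open>At 0 the diagonal terms have base 0 and exponent below 1, so \<open>F\<close>
    need not be differentiable there; continuity suffices at the endpoint.\<close>
  proof (rule DERIV_nonneg_imp_increasing_open[where f = F])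
    show "0 \<le> u" using assms by simp
    show "continuous_on {0..u} F"
      unfolding F_def using assms
      by (intro continuous_on_sum continuous_on_mult continuous_on_const
          continuous_on_powr' continuous_on_add continuous_on_id) auto
    show "\<exists>y. (F has_real_derivative y) (at w) \<and> 0 \<le> y" if "0 < w" for w
    proof (intro exI conjI)
      have pos: "0 < w + ?D i j" for i j
        using that by (intro add_pos_nonneg) auto
      show "(F has_real_derivative
          (\<Sum>i\<in>I. \<Sum>j\<in>I. c i * c j * (a * (w + ?D i j) powr (a - 1)))) (at w)"
        unfolding F_def
      proof (intro DERIV_sum DERIV_cmult)
        fix i j
        show "((\<lambda>u. (u + ?D i j) powr a) has_real_derivative a * (w + ?D i j) powr (a - 1)) (at w)"
          using DERIV_fun_powr[of "\<lambda>u. u + ?D i j" 1 w a] pos[of i j]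
          by (auto intro!: derivative_eq_intros)
      qed
      have "(\<Sum>i\<in>I. \<Sum>j\<in>I. c i * c j * (a * (w + ?D i j) powr (a - 1)))
          = a * (\<Sum>i\<in>I. \<Sum>j\<in>I. c i * c j * (w + ?D i j) powr - (1 - a))"
        by (simp add: sum_distrib_left mult_ac)
      also have "\<dots> \<ge> 0"
        using assms that by (intro mult_nonneg_nonneg inverse_multiquadric_kernel_nonneg) auto
      finally show "0 \<le> (\<Sum>i\<in>I. \<Sum>j\<in>I. c i * c j * (a * (w + ?D i j) powr (a - 1)))" .
    qed
  qed
  then show ?thesis by (simp add: F_def)
qed

lemma powr_shift_diff_tendsto_0:
  fixes a d :: real
  assumes "0 < a" and "a < 1"
  shows "((\<lambda>u. (u + d) powr a - u powr a) \<longlongrightarrow> 0) at_top"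
  using assms by real_asymp

lemma dist_powr_kernel_nonpos:
  fixes v :: "'i \<Rightarrow> 'a::euclidean_space" and c :: "'i \<Rightarrow> real"
  assumes "finite I" and "0 < r" and "r \<le> 2" and c: "(\<Sum>i\<in>I. c i) = 0"
  shows "(\<Sum>i\<in>I. \<Sum>j\<in>I. c i * c j * norm (v i - v j) powr r) \<le> 0"
\<comment> \<open>For \<open>r = 2\<close> the exponent \<open>a\<close> would be 1 and the shifted
  difference would tend to \<open>d\<close> instead of 0; the direct expansion covers this
  case.\<close>
proof (cases "r = 2")
  case True
  then show ?thesis
    using squared_dist_kernel_nonpos[OF c, of v] by simp
next
  case False
  define a where "a = r / 2"
  have a: "0 < a" "a < 1" using assms False by (auto simp: a_def)
  let ?D = "\<lambda>i j. (norm (v i - v j))\<^sup>2"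
  have D: "norm (v i - v j) powr r = ?D i j powr a" for i j
    by (simp add: a_def powr_powr flip: powr_numeral)
  define F where "F = (\<lambda>u. \<Sum>i\<in>I. \<Sum>j\<in>I. c i * c j * (u + ?D i j) powr a)"
  \<comment> \<open>Subtracting \<open>u powr a\<close> is free because the weights sum to 0, and it
    makes every term vanish in the limit.\<close>
  have F: "F u = (\<Sum>i\<in>I. \<Sum>j\<in>I. c i * c j * ((u + ?D i j) powr a - u powr a))" for u
  proof -
    have "(\<Sum>i\<in>I. \<Sum>j\<in>I. c i * c j * u powr a) = sum c I * sum c I * u powr a"
      by (subst sum_product) (simp only: sum_distrib_right)
    then show ?thesis
      using c by (simp add: F_def right_diff_distrib sum_subtractf)
  qed
  have "(F \<longlongrightarrow> (\<Sum>i\<in>I. \<Sum>j\<in>I. c i * c j * 0)) at_top"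
    unfolding F using a by (intro tendsto_sum tendsto_mult tendsto_const powr_shift_diff_tendsto_0)
  then have "(F \<longlongrightarrow> 0) at_top" by simp
  moreover have "\<forall>\<^sub>F u in at_top. (\<Sum>i\<in>I. \<Sum>j\<in>I. c i * c j * ?D i j powr a) \<le> F u"
    using eventually_gt_at_top[of 0]
    by eventually_elim (use assms a in \<open>auto simp: F_def intro: shifted_powr_kernel_mono\<close>)
  ultimately have "(\<Sum>i\<in>I. \<Sum>j\<in>I. c i * c j * ?D i j powr a) \<le> 0"
    by (rule tendsto_lowerbound) simp
  then show ?thesis by (simp add: D)
qed

section \<open>Validity of the cuts\<close>

lemma gradient_eqI:
  assumes "GDERIV f y :> D"
  shows "gradient f y = D"
  unfolding gradient_def
proof (rule the_equality[where P = "\<lambda>D. GDERIV f y :> D"])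
  fix D' assume "GDERIV f y :> D'"
  then have "(\<lambda>h. h \<bullet> D') = (\<lambda>h. h \<bullet> D)"
    using assms unfolding gderiv_def by (rule has_derivative_unique)
  then show "D' = D"
    by (simp add: fun_eq_iff vector_eq_ldot)
qed (fact assms)

lemma cut_self [simp]: "cut f y y = f y"
  by (simp add: cut_def)

lemma dist_matrix_self_adjoint:
  fixes v :: "'n::finite \<Rightarrow> real ^ 's"
  shows "(dist_matrix v r *v x) \<bullet> y = x \<bullet> (dist_matrix v r *v y)"
proof -
  have "transpose (dist_matrix v r) = dist_matrix v r"
    by (simp add: vec_eq_iff dist_matrix_def transpose_def norm_minus_commute)
  then show ?thesis
    by (metis dot_lmul_matrix transpose_matrix_vector)
qed

lemma gradient_dispersion:
  fixes v :: "'n::finite \<Rightarrow> real ^ 's"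
  shows "gradient (dispersion v r) y = dist_matrix v r *v y"
proof (rule gradient_eqI)
  let ?Q = "dist_matrix v r"
  have Q: "((*v) ?Q has_derivative (*v) ?Q) (at y)"
    by (rule bounded_linear_imp_has_derivative[OF matrix_vector_mul_bounded_linear])
  have "((\<lambda>x. 1 / 2 * ((?Q *v x) \<bullet> x)) has_derivative
      (\<lambda>h. 1 / 2 * ((?Q *v y) \<bullet> h + (?Q *v h) \<bullet> y))) (at y)"
    by (intro has_derivative_mult_right has_derivative_inner Q has_derivative_ident)
  also have "(\<lambda>h. 1 / 2 * ((?Q *v y) \<bullet> h + (?Q *v h) \<bullet> y)) = (\<lambda>h. h \<bullet> (?Q *v y))"
    using dist_matrix_self_adjoint[of v r _ y] by (simp add: inner_commute)
  finally show "GDERIV (dispersion v r) y :> ?Q *v y"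
    unfolding gderiv_def dispersion_def .
qed

text \<open>The second-order Taylor expansion of a quadratic form is exact: the error of the
  linearization is the form at the displacement.\<close>

lemma dispersion_sub_cut:
  fixes v :: "'n::finite \<Rightarrow> real ^ 's"
  shows "dispersion v r x - cut (dispersion v r) x y = dispersion v r (x - y)"
  unfolding cut_def gradient_dispersion
  using dist_matrix_self_adjoint[of v r x y]
  by (simp add: dispersion_def matrix_vector_mult_diff_distrib inner_diff inner_commute
      field_simps)

lemma dispersion_nonpos:
  fixes v :: "'n::finite \<Rightarrow> real ^ 's"
  assumes "0 < r" and "r \<le> 2" and "(\<Sum>i\<in>UNIV. d $ i) = 0"
  shows "dispersion v r d \<le> 0"
proof -
  have "dispersion v r d
      = 1 / 2 * (\<Sum>i\<in>UNIV. \<Sum>j\<in>UNIV. d $ i * d $ j * norm (v i - v j) powr r)"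
    by (simp add: dispersion_def dist_matrix_def matrix_vector_mult_def inner_vec_def
        sum_distrib_left sum_distrib_right mult_ac)
  then show ?thesis
    using dist_powr_kernel_nonpos[of UNIV r "\<lambda>i. d $ i" v] assms by simp
qed

text \<open>Two selections have the same coordinate sum \<open>p\<close>, so their difference is a
  direction in which the form is nonpositive.\<close>

lemma dispersion_le_cut:
  fixes v :: "'n::finite \<Rightarrow> real ^ 's"
  assumes "0 < r" and "r \<le> 2" and "x \<in> selections p" and "y \<in> selections p"
  shows "dispersion v r x \<le> cut (dispersion v r) x y"
proof -
  have "dispersion v r (x - y) \<le> 0"
    using assms by (intro dispersion_nonpos) (simp_all add: selections_def sum_subtractf)
  then show ?thesis
    using dispersion_sub_cut[of v r x y] by simp
qed

section \<open>Runs of the cutting plane algorithm\<close>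

lemma finite_selections: "finite (selections p :: (real ^ 'n::finite) set)"
proof (rule finite_subset)
  show "selections p \<subseteq> vec_lambda ` ((UNIV :: 'n set) \<rightarrow>\<^sub>E {0, 1 :: real})"
  proof
    fix x :: "real ^ 'n" assume "x \<in> selections p"
    then have "x = vec_lambda (vec_nth x)" and "vec_nth x \<in> UNIV \<rightarrow>\<^sub>E {0, 1}"
      by (auto simp: selections_def PiE_def)
    then show "x \<in> vec_lambda ` (UNIV \<rightarrow>\<^sub>E {0, 1})" by (rule image_eqI)
  qed
qed (intro finite_imageI finite_PiE; simp)

lemma cut_points_eq: "cut_points x k = x ` {..k}"
  by (induction k) (auto simp: atMost_Suc)

lemma le_lower_bound: "i \<le> k \<Longrightarrow> f (x i) \<le> lower_bound f x k"
  by (induction k) (auto simp: le_Suc_eq)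

lemma lower_bound_attained: "\<exists>j\<le>k. f (x j) = lower_bound f x k"
proof (induction k)
  case (Suc k)
  then obtain j where "j \<le> k" "f (x j) = lower_bound f x k" by blast
  then show ?case
    by (cases "lower_bound f x k \<le> f (x (Suc k))") (auto intro: exI[of _ j] exI[of _ "Suc k"])
qed simp

lemma cutting_plane_run_in:
  assumes "cutting_plane_run f K x \<theta> N" and "enat k \<le> N"
  shows "x k \<in> K"
  using assms by (cases k) (auto simp: cutting_plane_run_def cut_region_def)

lemma cutting_plane_run_new:
  assumes "cutting_plane_run f K x \<theta> N" and "enat j \<le> N" and "i < j"
  shows "x i \<noteq> x j"
proof
  assume eq: "x i = x j"
  \<comment> \<open>Iterate \<open>Suc k\<close> is tested against the cuts and the bound of stage
    \<open>k\<close>, both of which already include \<open>x i\<close>.\<close>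
  obtain k where k: "j = Suc k" "i \<le> k" using \<open>i < j\<close> by (cases j) auto
  have "\<theta> j \<le> cut f (x j) (x i)" and "lower_bound f x k < \<theta> j"
    using assms k by (auto simp: cutting_plane_run_def cut_region_def cut_points_eq)
  moreover have "f (x i) \<le> lower_bound f x k"
    using k by (intro le_lower_bound)
  ultimately show False using eq by simp
qed

lemma cutting_plane_run_finite:
  assumes run: "cutting_plane_run f K x \<theta> N" and "finite K"
  obtains m where "N = enat m"
proof (cases N)
  case infinity
  have "inj x"
    using cutting_plane_run_new[OF run] infinity by (intro linorder_injI) auto
  moreover have "range x \<subseteq> K"
    using cutting_plane_run_in[OF run] infinity by auto
  ultimately have "finite (UNIV :: nat set)"
    using \<open>finite K\<close> by (metis finite_imageD finite_subset)
  then show ?thesis by simp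
qed

lemma cutting_plane_run_optimal:
  assumes run: "cutting_plane_run f K x \<theta> (enat m)"
    and valid: "\<And>z y. z \<in> K \<Longrightarrow> y \<in> K \<Longrightarrow> f z \<le> cut f z y" and "z \<in> K"
  shows "f z \<le> lower_bound f x m"
proof -
  \<comment> \<open>Validity of the cuts makes this pair feasible, so the stopping condition forbids
    \<open>f z\<close> from exceeding the bound.\<close>
  have "(z, f z) \<in> cut_region f K (cut_points x m)"
    using \<open>z \<in> K\<close> valid cutting_plane_run_in[OF run] by (auto simp: cut_region_def cut_points_eq)
  then show ?thesis
    using run by (force simp: cutting_plane_run_def)
qed

theorem theorem1:
  fixes v :: "'n::finite \<Rightarrow> real ^ 's"
    and r :: real and p :: nat
    and x :: "nat \<Rightarrow> real ^ 'n" and \<theta> :: "nat \<Rightarrow> real" and N :: enat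
  assumes "0 < r" and "r \<le> 2"
    and "cutting_plane_run (dispersion v r) (selections p) x \<theta> N"
  shows "\<exists>m. N = enat m \<and>
           (\<forall>k\<le>m. x k \<in> selections p) \<and>
           (\<exists>j\<le>m. dispersion v r (x j) = lower_bound (dispersion v r) x m \<and>
                  is_arg_max (dispersion v r) (\<lambda>y. y \<in> selections p) (x j))"
proof -
  let ?f = "dispersion v r" and ?K = "selections p"
  obtain m where m: "N = enat m"
    using cutting_plane_run_finite[OF assms(3) finite_selections] .
  have run: "cutting_plane_run ?f ?K x \<theta> (enat m)"
    using assms(3) m by simp
  have in_K: "\<forall>k\<le>m. x k \<in> ?K"
    using cutting_plane_run_in[OF run] by simp
  \<comment> \<open>The optimal solution is the best iterate found, which may precede the last
    one.\<close>
  obtain j where j: "j \<le> m" "?f (x j) = lower_bound ?f x m"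
    using lower_bound_attained by blast
  have "?f z \<le> ?f (x j)" if "z \<in> ?K" for z
    using cutting_plane_run_optimal[OF run dispersion_le_cut[OF assms(1,2)] that] j by simp
  then have "is_arg_max ?f (\<lambda>y. y \<in> ?K) (x j)"
    using in_K j by (auto simp: is_arg_max_def not_less)
  then show ?thesis
    using m in_K j by blast
qed

end
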